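(* Let $\alpha\in(0,1)$, let $\lambda, k_{reg}\ge 0$ be fixed, and suppose $(X_i,Y_i,U_i)_{i=1,\dots,n}$ and $(X_{n+1},Y_{n+1},U_{n+1})$ are i.i.d., where $X_i\in\mathbb{R}^d$, $Y_i\in\mathcal{Y}=\{1,\dots,K\}$, and $U_i$ is uniform on $[0,1]$ and independent of $(X_i,Y_i)$. Let $\mathcal{C}^*(x,u,\tau)$ be the RAPS set $$\mathcal{C}^*(x,u,\tau)=\Big\{y\in\mathcal{Y} : \rho_x(y)+\hat{\pi}_x(y)\cdot u+\lambda\cdot(o_x(y)-k_{reg})^+\le\tau\Big\}.$$ Suppose further that $\hat{\pi}_x(y)>0$ for all $x\in\mathbb{R}^d$ and $y\in\mathcal{Y}$. Define $$\hat{\tau}_{\mathrm{ccal}}=\inf\left\{\tau\in\mathbb{R} : \frac{|\{i\in\{1,\dots,n\} : Y_i\in\mathcal{C}^*(X_i,U_i,\tau)\}|}{n}\ge\frac{\lceil(n+1)(1-\alpha)\rceil}{n}\right\}.$$ Then $$1-\alpha\le P\Big(Y_{n+1}\in\mathcal{C}^*(X_{n+1},U_{n+1},\hat{\tau}_{\mathrm{ccal}})\Big)\le 1-\alpha+\frac{1}{n+1}.$$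
   Context: Let $\mathcal{Y}=\{1,\dots,K\}$ be the finite set of labels. A fixed (non-random, i.e. trained on separate data), measurable base classifier assigns to every feature vector $x\in\mathbb{R}^d$ a probability vector $\hat{\pi}_x=(\hat{\pi}_x(1),\dots,\hat{\pi}_x(K))$, with $\hat{\pi}_x(y)\ge 0$ and $\sum_{y}\hat{\pi}_x(y)=1$. It is assumed that for each $x$ the values $\hat{\pi}_x(1),\dots,\hat{\pi}_x(K)$ are distinct. Notation: $\rho_x(y)=\sum_{y'=1}^K\hat{\pi}_x(y')\,\mathbb{I}_{\{\hat{\pi}_x(y')>\hat{\pi}_x(y)\}}$ is the total probability mass of labels strictly more likely than $y$; $o_x(y)=|\{y'\in\mathcal{Y}:\hat{\pi}_x(y')\ge\hat{\pi}_x(y)\}|$ is the rank of $y$ when labels are ordered from most to least likely; $(z)^+=\max(z,0)$ is the positive part of $z$. The infimum of the empty set is $+\infty$, and $\mathcal{C}^*(x,u,+\infty)=\mathcal{Y}$. *)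

theory Defs
  imports "HOL-Probability.Probability"
begin

definition mass_above :: "nat \<Rightarrow> ('a \<Rightarrow> nat \<Rightarrow> real) \<Rightarrow> 'a \<Rightarrow> nat \<Rightarrow> real" where
  "mass_above K \<pi> x y = (\<Sum>y'=1..K. \<pi> x y' * of_bool (\<pi> x y' > \<pi> x y))"

definition label_rank :: "nat \<Rightarrow> ('a \<Rightarrow> nat \<Rightarrow> real) \<Rightarrow> 'a \<Rightarrow> nat \<Rightarrow> nat" where
  "label_rank K \<pi> x y = card {y' \<in> {1..K}. \<pi> x y' \<ge> \<pi> x y}"

text \<open>
  The threshold ranges over the extended reals because the calibrated threshold below is an
  infimum of a possibly empty set of reals. The convention that the threshold \<open>\<infinity>\<close> yields
  the full label set need not be imposed: it follows from the order on \<^typ>\<open>ereal\<close>, as recorded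
  in \<open>raps_set_infinity\<close>.
\<close>

definition raps_set ::
  "nat \<Rightarrow> ('a \<Rightarrow> nat \<Rightarrow> real) \<Rightarrow> real \<Rightarrow> real \<Rightarrow> 'a \<Rightarrow> real \<Rightarrow> ereal \<Rightarrow> nat set" where
  "raps_set K \<pi> lam k_reg x u \<tau> =
    {y \<in> {1..K}. ereal (mass_above K \<pi> x y + \<pi> x y * u
                          + lam * max (real (label_rank K \<pi> x y) - k_reg) 0) \<le> \<tau>}"

lemma raps_set_infinity: "raps_set K \<pi> lam k_reg x u \<infinity> = {1..K}"
  by (auto simp: raps_set_def)

text \<open>
  Only real thresholds compete in the infimum; it is taken in \<^typ>\<open>ereal\<close>, where
  \<open>Inf {} = \<infinity>\<close>. The sample \<open>(xs i, ys i, us i)\<close> is used for \<open>i = 1, \<dots>, n\<close> only.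
\<close>

definition tau_ccal ::
  "nat \<Rightarrow> ('a \<Rightarrow> nat \<Rightarrow> real) \<Rightarrow> real \<Rightarrow> real \<Rightarrow> real \<Rightarrow> nat
    \<Rightarrow> (nat \<Rightarrow> 'a) \<Rightarrow> (nat \<Rightarrow> nat) \<Rightarrow> (nat \<Rightarrow> real) \<Rightarrow> ereal" where
  "tau_ccal K \<pi> lam k_reg \<alpha> n xs ys us =
    Inf (ereal ` {\<tau> :: real.
      real (card {i \<in> {1..n}. ys i \<in> raps_set K \<pi> lam k_reg (xs i) (us i) (ereal \<tau>)}) / real n
        \<ge> real_of_int \<lceil>(real n + 1) * (1 - \<alpha>)\<rceil> / real n})"

text \<open>
  Independence of two random variables. \<open>prob_space.indep_var\<close> cannot be used when the two
  variables take values in different types; this is the same notion, namely independence of the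
  families of events the two variables generate.
\<close>

definition indep_pair ::
  "'w measure \<Rightarrow> 'a measure \<Rightarrow> ('w \<Rightarrow> 'a) \<Rightarrow> 'b measure \<Rightarrow> ('w \<Rightarrow> 'b) \<Rightarrow> bool" where
  "indep_pair M S A T B \<longleftrightarrow>
    A \<in> measurable M S \<and> B \<in> measurable M T \<and>
    prob_space.indep_set M {A -` E \<inter> space M | E. E \<in> sets S} {B -` F \<inter> space M | F. F \<in> sets T}"

lemma indep_pair_iff_indep_var:
  assumes "prob_space M"
  shows "indep_pair M S A T B \<longleftrightarrow> prob_space.indep_var M S A T B"
proof -
  interpret prob_space M by fact
  have *: "sigma_sets (space M) {f -` E \<inter> space M | E. E \<in> sets N} = {f -` E \<inter> space M | E. E \<in> sets N}"
    if "f \<in> measurable M N" for f and N :: "'b measure"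
  proof -
    have "f \<in> space M \<rightarrow> space N"
      using that by (auto dest: measurable_space)
    then show ?thesis
      using sets_vimage_algebra[of "space M" f N] sets_vimage_algebra2[of f "space M" N] by simp
  qed
  show ?thesis
    unfolding indep_pair_def indep_var_eq by (auto simp: *)
qed

end

theory Submission
  imports Defs
begin

text \<open>
  The label \<open>Y i\<close> lies in the RAPS set at threshold \<open>\<tau>\<close> iff its score \<open>S i\<close> is at most \<open>\<tau>\<close>, so
  with \<open>m = \<lceil>(n + 1) (1 - \<alpha>)\<rceil>\<close> the test label is covered iff fewer than \<open>m\<close> of the
  scores \<open>S 1, \<dots>, S (n + 1)\<close> are strictly smaller than \<open>S (n + 1)\<close>. By exchangeability this
  has the same probability for every index in place of \<open>n + 1\<close>, and at least \<open>m\<close> indices, exactly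
  \<open>m\<close> without ties, have fewer than \<open>m\<close> scores below theirs. Hence the coverage is \<open>m / (n + 1)\<close>.
  There are almost surely no ties because \<open>\<pi> x y > 0\<close> makes the score strictly
  increasing in the independent uniform variable.
\<close>

section \<open>Ranks in finite families\<close>

lemma card_few_below_ge:
  fixes s :: "'i \<Rightarrow> 'a::linorder"
  assumes "finite I" "m \<le> card I"
  shows "m \<le> card {j \<in> I. card {i \<in> I. s i < s j} < m}"
proof (cases "{j \<in> I. card {i \<in> I. s i < s j} < m} = I")
  case False
  \<comment> \<open>\<open>R\<close> holds the indices with at least \<open>m\<close> scores
    strictly below theirs. At a minimiser \<open>j\<close> of \<open>s\<close> on \<open>R\<close>,
    none of the indices with a score below \<open>s j\<close> lies in \<open>R\<close>, so these
    indices, at least \<open>m\<close> in number, are all counted.\<close>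
  define R where "R = {j \<in> I. \<not> card {i \<in> I. s i < s j} < m}"
  have "finite R" "R \<noteq> {}"
    using False assms(1) by (auto simp: R_def)
  then obtain j where j: "j \<in> R" "\<And>i. i \<in> R \<Longrightarrow> s j \<le> s i"
    by (metis arg_min_if_finite(1) arg_min_least)
  have "m \<le> card {i \<in> I. s i < s j}"
    using j(1) by (auto simp: R_def)
  also have "\<dots> \<le> card {j \<in> I. card {i \<in> I. s i < s j} < m}"
    using assms(1) j(2) by (intro card_mono) (auto simp: R_def not_less[symmetric])
  finally show ?thesis .
qed (use assms in simp)

text \<open>Without ties the rank \<open>r\<close> is strictly increasing in the score, hence
  injective, and only the \<open>m\<close> values in \<open>{..<m}\<close> are available. With ties
  the bound can fail, because equal scores share one rank.\<close>

lemma card_few_below_le: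
  fixes s :: "'i \<Rightarrow> 'a::linorder"
  assumes "finite I" "inj_on s I"
  shows "card {j \<in> I. card {i \<in> I. s i < s j} < m} \<le> m"
proof -
  define r where "r j = card {i \<in> I. s i < s j}" for j
  have less: "r i < r j" if "s i < s j" "i \<in> I" for i j
    unfolding r_def using that assms(1) by (intro psubset_card_mono) (auto intro: less_trans)
  have "inj_on r I"
    by (rule inj_onI) (metis less less_irrefl inj_onD[OF assms(2)] neqE)
  then have "card {j \<in> I. r j < m} = card (r ` {j \<in> I. r j < m})"
    by (intro card_image[symmetric]) (auto intro: inj_on_subset)
  also have "\<dots> \<le> card {..<m}"
    by (intro card_mono) auto
  finally show ?thesis by (simp add: r_def)
qed

lemma all_le_iff_card_less:
  fixes s :: "'i \<Rightarrow> 'a::linorder"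
  assumes "finite I" "0 < m"
  shows "(\<forall>t. m \<le> card {i \<in> I. s i \<le> t} \<longrightarrow> c \<le> t) \<longleftrightarrow> card {i \<in> I. s i < c} < m"
proof
  assume *: "\<forall>t. m \<le> card {i \<in> I. s i \<le> t} \<longrightarrow> c \<le> t"
  show "card {i \<in> I. s i < c} < m"
  proof (rule ccontr)
    assume large: "\<not> card {i \<in> I. s i < c} < m"
    \<comment> \<open>The largest score below \<open>c\<close> is a threshold that is still smaller
      than \<open>c\<close> but already captures every score below \<open>c\<close>. Positivity of
      \<open>m\<close> guarantees that such a score exists.\<close>
    define t where "t = Max (s ` {i \<in> I. s i < c})"
    have ne: "{i \<in> I. s i < c} \<noteq> {}"
      using large assms(2) by (metis card.empty)
    then have "t \<in> s ` {i \<in> I. s i < c}"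
      unfolding t_def using assms(1) by (intro Max_in) auto
    then have "t < c" by auto
    have "{i \<in> I. s i < c} \<subseteq> {i \<in> I. s i \<le> t}"
      unfolding t_def using assms(1) by auto
    then have "card {i \<in> I. s i < c} \<le> card {i \<in> I. s i \<le> t}"
      using assms(1) by (intro card_mono) auto
    with large * \<open>t < c\<close> show False by (meson leD le_trans not_less)
  qed
next
  assume *: "card {i \<in> I. s i < c} < m"
  show "\<forall>t. m \<le> card {i \<in> I. s i \<le> t} \<longrightarrow> c \<le> t"
  proof (intro allI impI, rule ccontr)
    fix t assume t: "m \<le> card {i \<in> I. s i \<le> t}" "\<not> c \<le> t"
    then have "card {i \<in> I. s i \<le> t} \<le> card {i \<in> I. s i < c}"
      using assms(1) by (intro card_mono) auto
    with t * show False by simp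
  qed
qed

lemma measurable_card_filter:
  assumes "finite I" and meas: "\<And>i. i \<in> I \<Longrightarrow> Measurable.pred M (P i)"
  shows "(\<lambda>x. card {i \<in> I. P i x}) \<in> measurable M (count_space UNIV)"
  using assms
proof (induction I rule: finite_induct)
  case (insert i I)
  have "card {k \<in> insert i I. P k x} = (if P i x then Suc (card {k \<in> I. P k x}) else card {k \<in> I. P k x})" for x
  proof -
    have "{k \<in> insert i I. P k x} = (if P i x then insert i {k \<in> I. P k x} else {k \<in> I. P k x})"
      by auto
    then show ?thesis using insert.hyps by simp
  qed
  moreover have [measurable]: "Measurable.pred M (P i)" "(\<lambda>x. card {k \<in> I. P k x}) \<in> measurable M (count_space UNIV)"
    using insert by auto
  ultimately show ?case by simp
qed simp

section \<open>Ties and exchangeability for independent random variables\<close>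

context prob_space
begin

lemma indep_var_if_indep_vars:
  assumes "indep_vars N S I" "i \<in> I" "j \<in> I" "i \<noteq> j"
  shows "indep_var (N i) (S i) (N j) (S j)"
proof -
  have "indep_var (PiM {i} N) (\<lambda>\<omega>. restrict (\<lambda>k. S k \<omega>) {i}) (PiM {j} N) (\<lambda>\<omega>. restrict (\<lambda>k. S k \<omega>) {j})"
    using assms by (intro indep_var_restrict[OF assms(1)]) auto
  then have "indep_var (N i) ((\<lambda>f. f i) \<circ> (\<lambda>\<omega>. restrict (\<lambda>k. S k \<omega>) {i}))
      (N j) ((\<lambda>f. f j) \<circ> (\<lambda>\<omega>. restrict (\<lambda>k. S k \<omega>) {j}))"
    by (rule indep_var_compose) auto
  then show ?thesis by (simp add: comp_def)
qed

text \<open>By independence the joint law is a product, and each section of the diagonal is a single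
  point, which is null for the law of \<open>B\<close>. This serves twice: to exclude ties between
  two scores, and to show that a single score has no atoms.\<close>

lemma prob_eq_indep_atomless:
  fixes A B :: "'a \<Rightarrow> real"
  assumes indep: "indep_var borel A borel B"
    and atomless: "\<And>c. prob {\<omega> \<in> space M. B \<omega> = c} = 0"
  shows "prob {\<omega> \<in> space M. A \<omega> = B \<omega>} = 0"
proof -
  have [measurable]: "random_variable borel A" "random_variable borel B"
    and eq: "distr M borel A \<Otimes>\<^sub>M distr M borel B = distr M (borel \<Otimes>\<^sub>M borel) (\<lambda>\<omega>. (A \<omega>, B \<omega>))"
    using indep unfolding indep_var_distribution_eq by auto
  interpret B: prob_space "distr M borel B" by (rule prob_space_distr) simp
  have diag: "{p. fst p = snd p} \<in> sets (borel \<Otimes>\<^sub>M borel :: (real \<times> real) measure)"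
  proof -
    have "{p \<in> space (borel \<Otimes>\<^sub>M borel :: (real \<times> real) measure). fst p = snd p} \<in> sets (borel \<Otimes>\<^sub>M borel)"
      by measurable
    then show ?thesis by (simp add: space_pair_measure)
  qed
  have "emeasure M {\<omega> \<in> space M. A \<omega> = B \<omega>} =
      emeasure (distr M (borel \<Otimes>\<^sub>M borel) (\<lambda>\<omega>. (A \<omega>, B \<omega>))) {p. fst p = snd p}"
    using diag by (subst emeasure_distr) (auto intro!: arg_cong2[where f=emeasure])
  also have "\<dots> = (\<integral>\<^sup>+a. emeasure (distr M borel B) (Pair a -` {p. fst p = snd p}) \<partial>distr M borel A)"
    unfolding eq[symmetric] using diag by (intro B.emeasure_pair_measure_alt) (simp cong: sets_pair_measure_cong)
  also have "\<dots> = (\<integral>\<^sup>+a. 0 \<partial>distr M borel A)"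
  proof (rule nn_integral_cong)
    fix a
    have "emeasure (distr M borel B) (Pair a -` {p. fst p = snd p}) = emeasure M {\<omega> \<in> space M. B \<omega> = a}"
      by (subst emeasure_distr) (auto intro!: arg_cong2[where f=emeasure] simp: vimage_def)
    then show "emeasure (distr M borel B) (Pair a -` {p. fst p = snd p}) = 0"
      using atomless[of a] by (simp add: emeasure_eq_measure)
  qed
  finally show ?thesis by (simp add: measure_def)
qed

text \<open>The joint law of an i.i.d. family is a power of \<open>D\<close>, and such a power is
  invariant under injective reindexing. This is exchangeability.\<close>

lemma prob_eq_reindex_iid:
  fixes S :: "'i \<Rightarrow> 'a \<Rightarrow> 'b"
  assumes indep: "indep_vars (\<lambda>_. N) S I"
    and iid: "\<And>i. i \<in> I \<Longrightarrow> distr M N (S i) = D"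
    and f: "f \<in> I \<rightarrow> I" "inj_on f I"
    and A: "A \<in> sets (PiM I (\<lambda>_. N))" and "I \<noteq> {}"
  shows "prob {\<omega> \<in> space M. (\<lambda>i\<in>I. S (f i) \<omega>) \<in> A} = prob {\<omega> \<in> space M. (\<lambda>i\<in>I. S i \<omega>) \<in> A}"
proof -
  have rv: "random_variable N (S i)" if "i \<in> I" for i
    using indep that by (auto simp: indep_vars_def)
  have rvP: "random_variable (PiM I (\<lambda>_. N)) (\<lambda>\<omega>. \<lambda>i\<in>I. S i \<omega>)"
    "random_variable (PiM I (\<lambda>_. N)) (\<lambda>\<omega>. \<lambda>i\<in>I. S (f i) \<omega>)"
    using rv f(1) by (auto intro!: measurable_restrict)
  obtain i0 where "i0 \<in> I" using \<open>I \<noteq> {}\<close> by auto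
  have D: "prob_space D" and sets_D: "sets D = sets N"
    using iid[OF \<open>i0 \<in> I\<close>] prob_space_distr[OF rv[OF \<open>i0 \<in> I\<close>]] by auto
  have sets_P: "sets (PiM I (\<lambda>_. D)) = sets (PiM I (\<lambda>_. N))"
    by (intro sets_PiM_cong) (auto simp: sets_D)
  have law: "distr M (PiM I (\<lambda>_. N)) (\<lambda>\<omega>. \<lambda>i\<in>I. S i \<omega>) = PiM I (\<lambda>_. D)"
    using indep indep_vars_iff_distr_eq_PiM'[OF \<open>I \<noteq> {}\<close>, of S "\<lambda>_. N"] rv iid
    by (simp cong: PiM_cong)
  have re: "(\<lambda>g. \<lambda>i\<in>I. g (f i)) \<in> measurable (PiM I (\<lambda>_. N)) (PiM I (\<lambda>_. N))"
    using f(1) by (auto intro!: measurable_restrict measurable_component_singleton)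
  \<comment> \<open>Reindexing the variables amounts to applying the coordinate map
    \<open>g \<mapsto> g \<circ> f\<close> to the original random vector, so only the invariance of
    the product measure under that map remains.\<close>
  have "distr M (PiM I (\<lambda>_. N)) (\<lambda>\<omega>. \<lambda>i\<in>I. S (f i) \<omega>) =
      distr (distr M (PiM I (\<lambda>_. N)) (\<lambda>\<omega>. \<lambda>i\<in>I. S i \<omega>)) (PiM I (\<lambda>_. N)) (\<lambda>g. \<lambda>i\<in>I. g (f i))"
    unfolding distr_distr[OF re rvP(1)] using f(1)
    by (intro distr_cong) (auto simp: comp_def restrict_def fun_eq_iff)
  also have "\<dots> = distr (PiM I (\<lambda>_. D)) (PiM I (\<lambda>_. D)) (\<lambda>g. \<lambda>i\<in>I. g (f i))"
    unfolding law by (intro distr_cong) (auto simp: sets_P)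
  also have "\<dots> = PiM I (\<lambda>_. D)"
    using D f by (intro distr_PiM_reindex) auto
  also have "\<dots> = distr M (PiM I (\<lambda>_. N)) (\<lambda>\<omega>. \<lambda>i\<in>I. S i \<omega>)"
    by (rule law[symmetric])
  finally have "measure (distr M (PiM I (\<lambda>_. N)) (\<lambda>\<omega>. \<lambda>i\<in>I. S (f i) \<omega>)) A =
      measure (distr M (PiM I (\<lambda>_. N)) (\<lambda>\<omega>. \<lambda>i\<in>I. S i \<omega>)) A" by simp
  then show ?thesis
    using rvP A by (simp add: measure_distr vimage_def Int_def conj_commute)
qed

text \<open>The transposition of \<open>j\<close> and \<open>k\<close> carries the event for \<open>k\<close> to the event for \<open>j\<close>.\<close>

lemma prob_few_below_eq:
  fixes S :: "'i \<Rightarrow> 'a \<Rightarrow> real"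
  assumes indep: "indep_vars (\<lambda>_. borel) S I"
    and iid: "\<And>i. i \<in> I \<Longrightarrow> distr M borel (S i) = D"
    and I: "finite I" "j \<in> I" "k \<in> I"
  shows "prob {\<omega> \<in> space M. card {i \<in> I. S i \<omega> < S j \<omega>} < m} =
    prob {\<omega> \<in> space M. card {i \<in> I. S i \<omega> < S k \<omega>} < m}"
proof -
  define f where "f = Transposition.transpose j k"
  define A where "A = {g \<in> space (PiM I (\<lambda>_. borel :: real measure)). card {i \<in> I. g i < g k} < m}"
  have bij: "bij_betw f I I"
    by (simp add: f_def bij_betw_transpose_iff I(2,3))
  then have f: "f \<in> I \<rightarrow> I" "inj_on f I"
    by (auto simp: bij_betw_def)
  have fk: "f k = j" by (simp add: f_def)
  \<comment> \<open>Permuting the indices does not change how many scores lie below a fixed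
    \<open>c\<close>. Only the reference score changes, from index \<open>k\<close> to index
    \<open>f k = j\<close>.\<close>
  have card_eq: "card {i \<in> I. S (f i) \<omega> < c} = card {i \<in> I. S i \<omega> < c}" for \<omega> c
  proof -
    have "f ` {i \<in> I. S (f i) \<omega> < c} = {i \<in> I. S i \<omega> < c}"
      using bij by (auto simp: bij_betw_def)
    then show ?thesis
      by (metis (no_types, lifting) card_image f(2) inj_on_subset mem_Collect_eq subsetI)
  qed
  have A: "A \<in> sets (PiM I (\<lambda>_. borel))"
  proof -
    have [measurable]: "(\<lambda>g. g i) \<in> borel_measurable (PiM I (\<lambda>_. borel :: real measure))" if "i \<in> I" for i
      using that by measurable
    have "(\<lambda>g. card {i \<in> I. g i < g k}) \<in> measurable (PiM I (\<lambda>_. borel :: real measure)) (count_space UNIV)"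
      using I(1,3) by (intro measurable_card_filter) measurable
    from measurable_sets_Collect[OF this, of "\<lambda>c. c < m"] show ?thesis by (simp add: A_def)
  qed
  have "prob {\<omega> \<in> space M. (\<lambda>i\<in>I. S (f i) \<omega>) \<in> A} = prob {\<omega> \<in> space M. (\<lambda>i\<in>I. S i \<omega>) \<in> A}"
    using I by (intro prob_eq_reindex_iid[OF indep iid f A]) auto
  moreover have "(\<lambda>i\<in>I. S (f i) \<omega>) \<in> A \<longleftrightarrow> card {i \<in> I. S i \<omega> < S j \<omega>} < m" for \<omega>
    using I(3) by (simp add: A_def space_PiM fk card_eq cong: conj_cong)
  moreover have "(\<lambda>i\<in>I. S i \<omega>) \<in> A \<longleftrightarrow> card {i \<in> I. S i \<omega> < S k \<omega>} < m" for \<omega>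
    using I(3) by (simp add: A_def space_PiM cong: conj_cong)
  ultimately show ?thesis by simp
qed

text \<open>The events \<open>E j\<close> are equally likely, and almost surely exactly
  \<open>m\<close> of them occur. By linearity of expectation their probabilities sum to
  \<open>m\<close>, so each equals \<open>m / card I\<close>.\<close>

lemma prob_few_below:
  fixes S :: "'i \<Rightarrow> 'a \<Rightarrow> real"
  assumes indep: "indep_vars (\<lambda>_. borel) S I"
    and iid: "\<And>i. i \<in> I \<Longrightarrow> distr M borel (S i) = D"
    and atomless: "\<And>i c. i \<in> I \<Longrightarrow> prob {\<omega> \<in> space M. S i \<omega> = c} = 0"
    and I: "finite I" "k \<in> I" and m: "m \<le> card I"
  shows "prob {\<omega> \<in> space M. card {i \<in> I. S i \<omega> < S k \<omega>} < m} = m / card I"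
proof -
  define E where "E j = {\<omega> \<in> space M. card {i \<in> I. S i \<omega> < S j \<omega>} < m}" for j
  have rv [measurable]: "random_variable borel (S i)" if "i \<in> I" for i
    using indep that by (auto simp: indep_vars_def)
  have E: "E j \<in> events" if "j \<in> I" for j
  proof -
    have "(\<lambda>\<omega>. card {i \<in> I. S i \<omega> < S j \<omega>}) \<in> measurable M (count_space UNIV)"
      using I(1) that by (intro measurable_card_filter) measurable
    from measurable_sets_Collect[OF this, of "\<lambda>c. c < m"] show ?thesis by (simp add: E_def)
  qed
  have "AE \<omega> in M. S i \<omega> \<noteq> S j \<omega>" if "i \<in> I" "j \<in> I" "i \<noteq> j" for i j
  proof -
    have "prob {\<omega> \<in> space M. S i \<omega> = S j \<omega>} = 0"
      using prob_eq_indep_atomless[OF indep_var_if_indep_vars[OF indep that]] atomless that by blast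
    then show ?thesis
      using that by (subst AE_iff_measurable[OF _ refl]) (auto simp: emeasure_eq_measure)
  qed
  then have "AE \<omega> in M. \<forall>i\<in>I. \<forall>j\<in>I. i \<noteq> j \<longrightarrow> S i \<omega> \<noteq> S j \<omega>"
    using I(1) by (auto simp: AE_finite_all intro!: AE_finite_allI)
  then have ae: "AE \<omega> in M. (\<Sum>j\<in>I. indicator (E j) \<omega>) = real m"
    using AE_space
  proof eventually_elim
    case (elim \<omega>)
    then have "inj_on (\<lambda>i. S i \<omega>) I" and "\<omega> \<in> space M"
      by (auto simp: inj_on_def)
    then have "card {j \<in> I. card {i \<in> I. S i \<omega> < S j \<omega>} < m} = m"
      using I(1) m by (intro antisym card_few_below_le card_few_below_ge)
    moreover have "(\<Sum>j\<in>I. indicator (E j) \<omega>) = real (card {j \<in> I. \<omega> \<in> E j})"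
      using I(1) by (simp add: indicator_def sum.If_cases Int_def)
    ultimately show ?case
      using \<open>\<omega> \<in> space M\<close> by (simp add: E_def)
  qed
  have "real (card I) * prob (E k) = (\<Sum>j\<in>I. prob (E j))"
    using prob_few_below_eq[OF indep iid I(1) _ I(2), of _ m] by (simp add: E_def)
  also have "\<dots> = expectation (\<lambda>\<omega>. \<Sum>j\<in>I. indicator (E j) \<omega>)"
    using E by (subst Bochner_Integration.integral_sum) (auto simp: emeasure_eq_measure)
  also have "\<dots> = expectation (\<lambda>\<omega>. real m)"
    using E ae by (intro integral_cong_AE) (auto intro!: borel_measurable_sum)
  finally show ?thesis
    using I by (subst nonzero_eq_divide_eq) (auto simp: E_def prob_space mult.commute)
qed

end

section \<open>The RAPS score: calibration, measurability and absence of atoms\<close>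

definition raps_score :: "nat \<Rightarrow> ('a \<Rightarrow> nat \<Rightarrow> real) \<Rightarrow> real \<Rightarrow> real \<Rightarrow> 'a \<Rightarrow> nat \<Rightarrow> real \<Rightarrow> real" where
  "raps_score K \<pi> lam k_reg x y u =
    mass_above K \<pi> x y + \<pi> x y * u + lam * max (real (label_rank K \<pi> x y) - k_reg) 0"

lemma mem_raps_set_iff:
  "y \<in> raps_set K \<pi> lam k_reg x u \<tau> \<longleftrightarrow> y \<in> {1..K} \<and> ereal (raps_score K \<pi> lam k_reg x y u) \<le> \<tau>"
  by (simp add: raps_set_def raps_score_def)

text \<open>A score is at most an infimum iff it is at most every competing threshold, and
  \<open>all_le_iff_card_less\<close> turns this into a count. If \<open>m > n\<close>, no threshold
  competes, the calibrated one is infinite, and the count of at most \<open>n\<close> scores is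
  below \<open>m\<close> as well.\<close>

lemma mem_raps_set_tau_ccal_iff:
  assumes "n \<ge> 1" "0 < m" "int m = \<lceil>(real n + 1) * (1 - \<alpha>)\<rceil>"
    and ys: "\<And>i. i \<in> {1..n} \<Longrightarrow> ys i \<in> {1..K}" and y: "y \<in> {1..K}"
  shows "y \<in> raps_set K \<pi> lam k_reg x u (tau_ccal K \<pi> lam k_reg \<alpha> n xs ys us) \<longleftrightarrow>
    card {i \<in> {1..n}. raps_score K \<pi> lam k_reg (xs i) (ys i) (us i) < raps_score K \<pi> lam k_reg x y u} < m"
proof -
  let ?s = "\<lambda>i. raps_score K \<pi> lam k_reg (xs i) (ys i) (us i)"
  have m: "real_of_int \<lceil>(real n + 1) * (1 - \<alpha>)\<rceil> = real m"
    using assms(3) by (metis of_int_of_nat_eq)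
  have set_eq: "{i \<in> {1..n}. ys i \<in> raps_set K \<pi> lam k_reg (xs i) (us i) (ereal \<tau>)} = {i \<in> {1..n}. ?s i \<le> \<tau>}" for \<tau>
    using ys by (auto simp: mem_raps_set_iff)
  have "tau_ccal K \<pi> lam k_reg \<alpha> n xs ys us = Inf (ereal ` {\<tau>. m \<le> card {i \<in> {1..n}. ?s i \<le> \<tau>}})"
    unfolding tau_ccal_def m set_eq using assms(1) by (simp add: divide_le_cancel)
  then show ?thesis
    using y all_le_iff_card_less[of "{1..n}" m ?s] assms(2)
    by (simp add: mem_raps_set_iff le_Inf_iff)
qed

text \<open>Joint measurability follows from measurability for each fixed label, since there are
  only finitely many labels.\<close>

lemma measurable_label_dependent:
  fixes g :: "'a \<Rightarrow> nat \<Rightarrow> real"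
  assumes "\<And>y. y \<in> L \<Longrightarrow> (\<lambda>x. g x y) \<in> borel_measurable N" "finite L"
  shows "(\<lambda>(x, y). g x y) \<in> borel_measurable (N \<Otimes>\<^sub>M count_space L)"
proof -
  have "(\<lambda>p. g (fst p) (snd p)) \<in> borel_measurable (N \<Otimes>\<^sub>M count_space L)"
  proof (rule measurable_compose_countable'[where f="\<lambda>y p. g (fst p) y" and g=snd and I=L])
    show "(\<lambda>p. g (fst p) y) \<in> borel_measurable (N \<Otimes>\<^sub>M count_space L)" if "y \<in> L" for y
      using measurable_compose[OF measurable_fst assms(1)[OF that]] .
    show "countable L"
      using assms(2) by (rule countable_finite)
  qed simp
  then show ?thesis by (simp add: case_prod_beta)
qed

lemma raps_score_affine:
  "raps_score K \<pi> lam k_reg x y u = raps_score K \<pi> lam k_reg x y 0 + \<pi> x y * u"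
  by (simp add: raps_score_def)

lemma measurable_raps_score_0:
  assumes \<pi>: "\<And>y. y \<in> {1..K} \<Longrightarrow> (\<lambda>x. \<pi> x y) \<in> borel_measurable N"
  shows "(\<lambda>(x, y). raps_score K \<pi> lam k_reg x y 0) \<in> borel_measurable (N \<Otimes>\<^sub>M count_space {1..K})"
proof (rule measurable_label_dependent)
  fix y assume y: "y \<in> {1..K}"
  note [measurable] = \<pi> \<pi>[OF y]
  have [measurable]: "(\<lambda>x. mass_above K \<pi> x y) \<in> borel_measurable N"
    unfolding mass_above_def of_bool_def by measurable
  have [measurable]: "(\<lambda>x. label_rank K \<pi> x y) \<in> measurable N (count_space UNIV)"
    unfolding label_rank_def by (rule measurable_card_filter) measurable
  show "(\<lambda>x. raps_score K \<pi> lam k_reg x y 0) \<in> borel_measurable N"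
    unfolding raps_score_def by measurable
qed simp

lemma measurable_raps_score:
  assumes \<pi>: "\<And>y. y \<in> {1..K} \<Longrightarrow> (\<lambda>x. \<pi> x y) \<in> borel_measurable N"
  shows "(\<lambda>(x, y, u). raps_score K \<pi> lam k_reg x y u)
    \<in> borel_measurable (N \<Otimes>\<^sub>M count_space {1..K} \<Otimes>\<^sub>M borel)"
proof -
  let ?P = "N \<Otimes>\<^sub>M count_space {1..K} \<Otimes>\<^sub>M (borel :: real measure)"
  have xy: "(\<lambda>p. (fst p, fst (snd p))) \<in> measurable ?P (N \<Otimes>\<^sub>M count_space {1..K})"
    by measurable
  have [measurable]: "(\<lambda>p. raps_score K \<pi> lam k_reg (fst p) (fst (snd p)) 0) \<in> borel_measurable ?P"
    using measurable_compose[OF xy measurable_raps_score_0[OF \<pi>]] by simp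
  have [measurable]: "(\<lambda>p. \<pi> (fst p) (fst (snd p))) \<in> borel_measurable ?P"
    using measurable_compose[OF xy measurable_label_dependent[OF \<pi>]] by simp
  have "(\<lambda>p. raps_score K \<pi> lam k_reg (fst p) (fst (snd p)) 0 + \<pi> (fst p) (fst (snd p)) * snd (snd p))
      \<in> borel_measurable ?P"
    by measurable
  moreover have "(\<lambda>(x, y, u). raps_score K \<pi> lam k_reg x y u) =
      (\<lambda>p. raps_score K \<pi> lam k_reg (fst p) (fst (snd p)) 0 + \<pi> (fst p) (fst (snd p)) * snd (snd p))"
    by (auto simp: fun_eq_iff raps_score_def)
  ultimately show ?thesis by simp
qed

text \<open>Every event generated by \<open>f \<circ> A\<close> is already generated by
  \<open>A\<close>. Mapping \<open>A\<close> into the space of \<open>B\<close> brings both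
  variables to one type, where \<open>indep_var\<close> applies.\<close>

lemma (in prob_space) indep_var_of_indep_pair:
  assumes "indep_pair M S A T B" and f: "f \<in> measurable S T"
  shows "indep_var T (f \<circ> A) T B"
proof -
  have A: "A \<in> measurable M S" and B: "B \<in> measurable M T"
    and ind: "indep_set {A -` E \<inter> space M | E. E \<in> sets S} {B -` F \<inter> space M | F. F \<in> sets T}"
    using assms(1) by (auto simp: indep_pair_def)
  have "{(f \<circ> A) -` E \<inter> space M | E. E \<in> sets T} \<subseteq> {A -` E \<inter> space M | E. E \<in> sets S}"
  proof clarify
    fix E assume "E \<in> sets T"
    then have "f -` E \<inter> space S \<in> sets S"
      using f by (rule measurable_sets[rotated])
    moreover have "(f \<circ> A) -` E \<inter> space M = A -` (f -` E \<inter> space S) \<inter> space M"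
      using measurable_space[OF A] by auto
    ultimately show "\<exists>F. (f \<circ> A) -` E \<inter> space M = A -` F \<inter> space M \<and> F \<in> sets S"
      by blast
  qed
  then have "indep_set {(f \<circ> A) -` E \<inter> space M | E. E \<in> sets T} {B -` F \<inter> space M | F. F \<in> sets T}"
    using ind unfolding indep_set_def
    by (elim indep_sets_mono_sets) (auto split: bool.split)
  then have "indep_pair M T (f \<circ> A) T B"
    unfolding indep_pair_def using measurable_comp[OF A f] B by blast
  then show ?thesis
    by (simp only: indep_pair_iff_indep_var[OF prob_space_axioms])
qed

text \<open>The score is affine in \<open>U\<close> with positive slope, so it equals
  \<open>c\<close> exactly when \<open>U\<close> equals a certain measurable function
  \<open>?f\<close> of \<open>(X, Y)\<close>. As \<open>U\<close> is atomless and independent of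
  \<open>(X, Y)\<close>, this has probability zero.\<close>

lemma (in prob_space) raps_score_atomless:
  fixes X :: "'a \<Rightarrow> 'b" and U :: "'a \<Rightarrow> real"
  assumes \<pi>: "\<And>y. y \<in> {1..K} \<Longrightarrow> (\<lambda>x. \<pi> x y) \<in> borel_measurable N"
    and pos: "\<And>x y. y \<in> {1..K} \<Longrightarrow> \<pi> x y > 0"
    and indep: "indep_pair M (N \<Otimes>\<^sub>M count_space {1..K}) (\<lambda>\<omega>. (X \<omega>, Y \<omega>)) borel U"
    and atomless: "\<And>c. prob {\<omega> \<in> space M. U \<omega> = c} = 0"
  shows "prob {\<omega> \<in> space M. raps_score K \<pi> lam k_reg (X \<omega>) (Y \<omega>) (U \<omega>) = c} = 0"
proof -
  let ?P = "N \<Otimes>\<^sub>M count_space {1..K}"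
  let ?f = "\<lambda>p. (c - raps_score K \<pi> lam k_reg (fst p) (snd p) 0) / \<pi> (fst p) (snd p)"
  have [measurable]: "(\<lambda>p. raps_score K \<pi> lam k_reg (fst p) (snd p) 0) \<in> borel_measurable ?P"
    using measurable_raps_score_0[OF \<pi>] by (simp add: case_prod_beta)
  have [measurable]: "(\<lambda>p. \<pi> (fst p) (snd p)) \<in> borel_measurable ?P"
    using measurable_label_dependent[of "{1..K}" \<pi>, OF \<pi>] by (simp add: case_prod_beta)
  have "?f \<in> borel_measurable ?P"
    by measurable
  then have "prob {\<omega> \<in> space M. (?f \<circ> (\<lambda>\<omega>. (X \<omega>, Y \<omega>))) \<omega> = U \<omega>} = 0"
    using prob_eq_indep_atomless[OF indep_var_of_indep_pair[OF indep] atomless] by blast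
  moreover have "(?f \<circ> (\<lambda>\<omega>. (X \<omega>, Y \<omega>))) \<omega> = U \<omega> \<longleftrightarrow> raps_score K \<pi> lam k_reg (X \<omega>) (Y \<omega>) (U \<omega>) = c"
    if "\<omega> \<in> space M" for \<omega>
  proof -
    \<comment> \<open>Measurability into \<open>count_space {1..K}\<close> forces the label into
      \<open>{1..K}\<close>, the range where \<open>\<pi>\<close> is known to be positive.\<close>
    have "(\<lambda>\<omega>. (X \<omega>, Y \<omega>)) \<in> measurable M (N \<Otimes>\<^sub>M count_space {1..K})"
      using indep by (simp add: indep_pair_def)
    from measurable_space[OF this that] have "\<pi> (X \<omega>) (Y \<omega>) > 0"
      by (auto simp: space_pair_measure intro: pos)
    then show ?thesis
      using raps_score_affine[of K \<pi> lam k_reg "X \<omega>" "Y \<omega>" "U \<omega>"]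
      by (auto simp: divide_eq_eq mult.commute)
  qed
  ultimately show ?thesis by (simp cong: conj_cong)
qed

section \<open>Coverage probability of the calibrated sets\<close>

theorem proposition1:
  fixes M :: "'w measure"
    and X :: "nat \<Rightarrow> 'w \<Rightarrow> real ^ 'd"
    and Y :: "nat \<Rightarrow> 'w \<Rightarrow> nat"
    and U :: "nat \<Rightarrow> 'w \<Rightarrow> real"
    and \<pi> :: "real ^ 'd \<Rightarrow> nat \<Rightarrow> real"
    and K n :: nat
    and \<alpha> lam k_reg :: real
  assumes "prob_space M"
    and "n \<ge> 1"
    and "0 < \<alpha>" and "\<alpha> < 1"
    and "lam \<ge> 0" and "k_reg \<ge> 0"
    and classifier_measurable: "\<And>y. y \<in> {1..K} \<Longrightarrow> (\<lambda>x. \<pi> x y) \<in> borel_measurable borel"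
    and classifier_nonneg: "\<And>x y. y \<in> {1..K} \<Longrightarrow> \<pi> x y \<ge> 0"
    and classifier_sum: "\<And>x. (\<Sum>y=1..K. \<pi> x y) = 1"
    and classifier_distinct: "\<And>x. inj_on (\<pi> x) {1..K}"
    and classifier_pos: "\<And>x y. y \<in> {1..K} \<Longrightarrow> \<pi> x y > 0"
    and independent: "prob_space.indep_vars M
          (\<lambda>i. borel \<Otimes>\<^sub>M count_space {1..K} \<Otimes>\<^sub>M borel)
          (\<lambda>i \<omega>. (X i \<omega>, Y i \<omega>, U i \<omega>)) {1..n+1}"
    and identically_distributed: "\<And>i j. i \<in> {1..n+1} \<Longrightarrow> j \<in> {1..n+1} \<Longrightarrow>
          distr M (borel \<Otimes>\<^sub>M count_space {1..K} \<Otimes>\<^sub>M borel) (\<lambda>\<omega>. (X i \<omega>, Y i \<omega>, U i \<omega>)) =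
          distr M (borel \<Otimes>\<^sub>M count_space {1..K} \<Otimes>\<^sub>M borel) (\<lambda>\<omega>. (X j \<omega>, Y j \<omega>, U j \<omega>))"
    and uniform: "\<And>i. i \<in> {1..n+1} \<Longrightarrow> distr M borel (U i) = uniform_measure lborel {0..1}"
    and U_independent: "\<And>i. i \<in> {1..n+1} \<Longrightarrow>
          indep_pair M (borel \<Otimes>\<^sub>M count_space {1..K}) (\<lambda>\<omega>. (X i \<omega>, Y i \<omega>)) borel (U i)"
  shows "1 - \<alpha> \<le>
      \<P>(\<omega> in M. Y (n+1) \<omega> \<in> raps_set K \<pi> lam k_reg (X (n+1) \<omega>) (U (n+1) \<omega>)
        (tau_ccal K \<pi> lam k_reg \<alpha> n (\<lambda>i. X i \<omega>) (\<lambda>i. Y i \<omega>) (\<lambda>i. U i \<omega>)))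
    \<and> \<P>(\<omega> in M. Y (n+1) \<omega> \<in> raps_set K \<pi> lam k_reg (X (n+1) \<omega>) (U (n+1) \<omega>)
        (tau_ccal K \<pi> lam k_reg \<alpha> n (\<lambda>i. X i \<omega>) (\<lambda>i. Y i \<omega>) (\<lambda>i. U i \<omega>)))
      \<le> 1 - \<alpha> + 1 / (real n + 1)"
proof -
  interpret prob_space M by fact
  let ?T = "(borel :: (real ^ 'd) measure) \<Otimes>\<^sub>M count_space {1..K} \<Otimes>\<^sub>M (borel :: real measure)"
  \<comment> \<open>All scores are images of the sample triples under one measurable map, so they
    inherit independence and a common law.\<close>
  define sc where "sc = (\<lambda>(x, y, u). raps_score K \<pi> lam k_reg x y u)"
  define S where "S i \<omega> = raps_score K \<pi> lam k_reg (X i \<omega>) (Y i \<omega>) (U i \<omega>)" for i \<omega>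
  have sc: "sc \<in> borel_measurable ?T"
    unfolding sc_def using classifier_measurable by (rule measurable_raps_score)
  have S_eq: "S i = sc \<circ> (\<lambda>\<omega>. (X i \<omega>, Y i \<omega>, U i \<omega>))" for i
    by (simp add: S_def sc_def fun_eq_iff)
  have rv: "(\<lambda>\<omega>. (X i \<omega>, Y i \<omega>, U i \<omega>)) \<in> measurable M ?T" if "i \<in> {1..n+1}" for i
    using independent that by (auto simp: indep_vars_def)
  have indep: "indep_vars (\<lambda>_. borel) S {1..n+1}"
    unfolding S_eq using independent sc by (rule indep_vars_compose)
  have iid: "distr M borel (S i) = distr M borel (S (n+1))" if "i \<in> {1..n+1}" for i
    unfolding S_eq using that identically_distributed[of i "n+1"]
    by (simp add: distr_distr[OF sc rv, symmetric])
  have U_rv: "random_variable borel (U i)" if "i \<in> {1..n+1}" for i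
    using U_independent[OF that] by (simp add: indep_pair_def)
  have U_atomless: "prob {\<omega> \<in> space M. U i \<omega> = c} = 0" if "i \<in> {1..n+1}" for i c
  proof -
    have "prob {\<omega> \<in> space M. U i \<omega> = c} = measure (distr M borel (U i)) {c}"
      using U_rv[OF that] by (simp add: measure_distr vimage_def Int_def conj_commute)
    also have "\<dots> = 0"
    proof -
      have "emeasure lborel ({0..1} \<inter> {c}) \<le> emeasure lborel {c}"
        by (rule emeasure_mono) auto
      then show ?thesis
        unfolding uniform[OF that] by (simp add: measure_def)
    qed
    finally show ?thesis .
  qed
  have S_atomless: "prob {\<omega> \<in> space M. S i \<omega> = c} = 0" if "i \<in> {1..n+1}" for i c
    unfolding S_def using classifier_measurable classifier_pos U_independent[OF that] U_atomless[OF that]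
    by (rule raps_score_atomless[where N=borel])
  define m where "m = nat \<lceil>(real n + 1) * (1 - \<alpha>)\<rceil>"
  have arg_pos: "0 < (real n + 1) * (1 - \<alpha>)"
    using \<open>\<alpha> < 1\<close> by simp
  have m: "int m = \<lceil>(real n + 1) * (1 - \<alpha>)\<rceil>" "0 < m"
    using arg_pos by (auto simp: m_def)
  \<comment> \<open>Rounding up adds at most one. After division by \<open>n + 1\<close> these
    bounds become the two sides of the claim.\<close>
  have m_bounds: "(real n + 1) * (1 - \<alpha>) \<le> m" "m \<le> (real n + 1) * (1 - \<alpha>) + 1"
    using m(1) by linarith+
  \<comment> \<open>Since \<open>\<alpha>\<close> is positive, \<open>m\<close> does not exceed the
    number of scores \<open>n + 1\<close>, as required for exactly \<open>m\<close> of them to have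
    rank below \<open>m\<close>.\<close>
  have "(real n + 1) * (1 - \<alpha>) \<le> of_int (int n + 1)"
    using \<open>0 < \<alpha>\<close> by (simp add: mult_left_le)
  then have "int m \<le> int n + 1"
    unfolding m(1) by (simp only: ceiling_le_iff)
  then have m_le: "m \<le> card {1..n+1}"
    by simp
  have covered: "Y (n+1) \<omega> \<in> raps_set K \<pi> lam k_reg (X (n+1) \<omega>) (U (n+1) \<omega>)
        (tau_ccal K \<pi> lam k_reg \<alpha> n (\<lambda>i. X i \<omega>) (\<lambda>i. Y i \<omega>) (\<lambda>i. U i \<omega>)) \<longleftrightarrow>
      card {i \<in> {1..n+1}. S i \<omega> < S (n+1) \<omega>} < m" if "\<omega> \<in> space M" for \<omega>
  proof -
    have Y: "Y i \<omega> \<in> {1..K}" if "i \<in> {1..n+1}" for i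
      using measurable_space[OF rv[OF that] \<open>\<omega> \<in> space M\<close>] by (auto simp: space_pair_measure)
    \<comment> \<open>The test score is not strictly below itself, so it may join the calibration
      scores in the count. The event then ranks the test score within the whole exchangeable
      family.\<close>
    have "{i \<in> {1..n+1}. S i \<omega> < S (n+1) \<omega>} = {i \<in> {1..n}. S i \<omega> < S (n+1) \<omega>}"
      by (auto simp: le_Suc_eq)
    then show ?thesis
      using mem_raps_set_tau_ccal_iff[OF \<open>n \<ge> 1\<close> m(2,1), of "\<lambda>i. Y i \<omega>" K "Y (n+1) \<omega>"] Y
      by (simp add: S_def)
  qed
  have "prob {\<omega> \<in> space M. card {i \<in> {1..n+1}. S i \<omega> < S (n+1) \<omega>} < m} = m / card {1..n+1}"
    using m_le by (intro prob_few_below[OF indep iid S_atomless]) auto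
  then have "\<P>(\<omega> in M. Y (n+1) \<omega> \<in> raps_set K \<pi> lam k_reg (X (n+1) \<omega>) (U (n+1) \<omega>)
        (tau_ccal K \<pi> lam k_reg \<alpha> n (\<lambda>i. X i \<omega>) (\<lambda>i. Y i \<omega>) (\<lambda>i. U i \<omega>))) = m / (real n + 1)"
    using covered by (simp cong: conj_cong add: add.commute)
  moreover have "1 - \<alpha> \<le> m / (real n + 1)"
    using m_bounds(1) by (simp add: pos_le_divide_eq mult.commute)
  moreover have "m / (real n + 1) \<le> 1 - \<alpha> + 1 / (real n + 1)"
    using divide_right_mono[OF m_bounds(2), of "real n + 1"] by (simp add: add_divide_distrib)
  ultimately show ?thesis
    by simp
qed

end
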